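(* The function $t_M(x)=t_M([0,x])$ is continuous on $(0,\infty)$.
   Context: Let $\mathcal{M}_n[x]$ denote the set of monic polynomials of degree $n$ with integer coefficients, and for a polynomial $p$ and closed interval $I\subset\mathbb{R}$ let $\|p\|_I=\sup_{x\in I}|p(x)|$. The monic integer transfinite diameter of a closed interval $I$ is $t_M(I)=\lim_{n\to\infty}\inf_{p_n\in\mathcal{M}_n[x]}\|p_n\|_I^{1/n}$. For $x>0$ set $t_M(x)=t_M([0,x])$. *)

theory Defs
  imports Complex_Main "HOL-Computational_Algebra.Polynomial"
begin

definition monic_int_polys :: "nat \<Rightarrow> int poly set" where
  "monic_int_polys n = {p. degree p = n \<and> lead_coeff p = 1}"

definition sup_norm_on :: "real set \<Rightarrow> int poly \<Rightarrow> real" where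
  "sup_norm_on I p = (SUP x\<in>I. \<bar>poly (map_poly real_of_int p) x\<bar>)"

text \<open>
  The limit exists for every nondegenerate compact interval, since the infimum of the norms is
  submultiplicative in \<open>n\<close> and positive. The term for \<open>n = 0\<close> does not affect it.
\<close>
definition monic_int_transfinite_diameter :: "real set \<Rightarrow> real" where
  "monic_int_transfinite_diameter I =
     lim (\<lambda>n. INF p\<in>monic_int_polys n. sup_norm_on I p powr (1 / real n))"

definition t_M :: "real \<Rightarrow> real" where
  "t_M x = monic_int_transfinite_diameter {0..x}"

end

theory Submission
  imports Defs "HOL-Complex_Analysis.Conformal_Mappings"
begin

text \<open>
  A polynomial of degree \<open>n\<close> bounded by \<open>M\<close> on \<open>[0,y]\<close> is bounded by
  \<open>M \<phi>(x/y)^n\<close> on \<open>[0,x]\<close> for \<open>x \<ge> y\<close>, where \<open>\<phi>(s) = (\<surd>s + \<surd>(s - 1))\<^sup>2\<close>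
  (Bernstein's growth inequality, via the Joukowski substitution and the maximum modulus
  principle). Taking infima over monic integer polynomials and \<open>n\<close>-th roots,
  \<open>t\<^sub>M(y) \<le> t\<^sub>M(x) \<le> t\<^sub>M(y) \<phi>(x/y)\<close>, and \<open>\<phi>\<close> is continuous with \<open>\<phi>(1) = 1\<close>.
  The defining limit exists by a Fekete-type argument: a good polynomial \<open>p\<close> of degree \<open>m\<close>
  yields the good polynomials \<open>x^r p^q\<close> in all degrees \<open>qm + r\<close>.
\<close>

section \<open>Bernstein growth of a real polynomial beyond an interval\<close>

definition growth_factor :: "real \<Rightarrow> real" where
  "growth_factor s = (sqrt s + sqrt (s - 1))\<^sup>2"

lemma growth_factor_ge_1: "1 \<le> s \<Longrightarrow> 1 \<le> growth_factor s"
  unfolding growth_factor_def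
  by (rule one_le_power) (metis add_increasing2 diff_ge_0_iff_ge real_sqrt_ge_one real_sqrt_ge_zero)

lemma growth_factor_mono: "1 \<le> s \<Longrightarrow> s \<le> t \<Longrightarrow> growth_factor s \<le> growth_factor t"
  unfolding growth_factor_def by (intro power_mono add_mono) auto

text \<open>So \<open>v\<close> is a preimage of \<open>s\<close> in \<open>(0,1]\<close> under the
  Joukowski-type map \<open>w -> (1 + w)^2 / (4 w)\<close>. With \<open>a = sqrt s\<close> and
  \<open>b = sqrt (s - 1)\<close>, the relation \<open>a^2 - b^2 = 1\<close> turns
  \<open>1 / (a + b)^2\<close> into \<open>(a - b)^2\<close>.\<close>

lemma growth_factor_Joukowski:
  assumes "1 \<le> s" and v: "v = 1 / growth_factor s"
  shows "4 * s * v = (1 + v)\<^sup>2"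
proof -
  define a b where "a = sqrt s" and "b = sqrt (s - 1)"
  have ab: "a\<^sup>2 = s" "b\<^sup>2 = s - 1" "a \<ge> 1" "b \<ge> 0"
    using assms by (auto simp: a_def b_def)
  have "(a - b)\<^sup>2 * (a + b)\<^sup>2 = (a\<^sup>2 - b\<^sup>2)\<^sup>2"
    by (simp add: power2_eq_square algebra_simps)
  then have "(a - b)\<^sup>2 * (a + b)\<^sup>2 = 1"
    by (simp add: ab)
  moreover have "a + b > 0"
    using ab by linarith
  ultimately have v': "v = (a - b)\<^sup>2"
    unfolding v growth_factor_def a_def[symmetric] b_def[symmetric] by (simp add: field_simps)
  have "1 = a\<^sup>2 - b\<^sup>2"
    by (simp add: ab)
  then have "1 + v = 2 * a * (a - b)"
    unfolding v' by (simp add: power2_eq_square algebra_simps)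
  then show ?thesis
    unfolding v' ab(1)[symmetric] by (simp add: power_mult_distrib)
qed

text \<open>The map \<open>w -> y (1 + w)^2 / (4 w)\<close> sends the unit circle onto
  \<open>[0,y]\<close> and \<open>v = 1 / growth_factor (z / y)\<close> to \<open>z\<close>. The
  pullback of \<open>p\<close> times \<open>w^n\<close> has no pole, is bounded by \<open>M\<close>
  on the circle and hence on the disc. Its value at \<open>v\<close> is \<open>v^n\<close> times
  \<open>p(z)\<close>.\<close>

lemma poly_growth_outside_interval:
  fixes p :: "real poly"
  assumes y: "0 < y" and bound: "\<And>t. t \<in> {0..y} \<Longrightarrow> \<bar>poly p t\<bar> \<le> M" and z: "y \<le> z"
  shows "\<bar>poly p z\<bar> \<le> M * growth_factor (z / y) ^ degree p"
proof -
  define n where "n = degree p"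
  \<comment> \<open>\<open>G w\<close> is \<open>w^n p(y (1 + w)^2 / (4 w))\<close> with
    denominators cleared, hence a polynomial in \<open>w\<close>, holomorphic also at 0.\<close>
  define G :: "complex \<Rightarrow> complex" where
    "G w = (\<Sum>k\<le>n. of_real (coeff p k) * (of_real (y/4) * (1 + w)\<^sup>2) ^ k * w ^ (n - k))" for w
  have G_eq: "G w = w ^ n * of_real (poly p t)"
    if "of_real t * w = of_real (y/4) * (1 + w)\<^sup>2" for w t
  proof -
    have "(of_real (y/4) * (1 + w)\<^sup>2) ^ k * w ^ (n - k) = of_real (t ^ k) * w ^ n"
      if "k \<le> n" for k
      unfolding \<open>of_real t * w = _\<close>[symmetric] using that
      by (simp add: power_mult_distrib power_add[symmetric] mult.assoc)
    then show ?thesis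
      unfolding G_def poly_altdef n_def[symmetric] of_real_sum sum_distrib_left
      by (intro sum.cong) (auto simp: mult.assoc mult_ac)
  qed
  have on_circle: "norm (G w) \<le> M" if "norm w = 1" for w
  proof -
    \<comment> \<open>For \<open>|w| = 1\<close>, \<open>1 / w = cnj w\<close>, so
      \<open>(1 + w)^2 / w = 2 + w + cnj w = 2 (1 + Re w)\<close> is real.\<close>
    define t where "t = y/2 * (1 + Re w)"
    have Re: "\<bar>Re w\<bar> \<le> 1"
      using abs_Re_le_cmod[of w] that by simp
    have "w * (w + cnj w) = w\<^sup>2 + 1"
      using complex_norm_square[of w] that by (simp add: power2_eq_square algebra_simps)
    then have "2 * of_real (Re w) * w = w\<^sup>2 + 1"
      by (simp add: complex_add_cnj mult.commute)
    then have "2 * (1 + of_real (Re w)) * w = (1 + w)\<^sup>2"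
      by (simp add: power2_eq_square algebra_simps)
    then have "of_real t * w = of_real (y/4) * (1 + w)\<^sup>2"
      by (simp add: t_def flip: \<open>_ = (1 + w)\<^sup>2\<close>)
    from G_eq[OF this] have "norm (G w) = \<bar>poly p t\<bar>"
      using that by (simp add: norm_mult norm_power)
    also have "t \<in> {0..y}"
      using Re y mult_left_le[of "(1 + Re w)/2" y] by (auto simp: t_def)
    then have "\<bar>poly p t\<bar> \<le> M"
      by (rule bound)
    finally show ?thesis .
  qed
  have G_le: "norm (G w) \<le> M" if "norm w \<le> 1" for w
  proof (rule maximum_modulus_frontier[of G "cball 0 1"])
    show "G holomorphic_on interior (cball 0 1)" "continuous_on (closure (cball 0 1)) G"
      unfolding G_def by (intro holomorphic_intros continuous_intros)+
    show "norm (G u) \<le> M" if "u \<in> frontier (cball 0 1)" for u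
      using that on_circle by (simp add: frontier_cball)
  qed (use that in auto)
  define v where "v = 1 / growth_factor (z / y)"
  have g: "1 \<le> growth_factor (z / y)"
    using y z by (intro growth_factor_ge_1) simp
  have v: "0 < v" "v \<le> 1"
    using g by (auto simp: v_def)
  have "z * v = y/4 * (1 + v)\<^sup>2"
    using growth_factor_Joukowski[OF _ v_def] y z by (simp add: field_simps)
  then have "of_real z * of_real v = (of_real (y/4) * (1 + of_real v)\<^sup>2 :: complex)"
    by (metis of_real_1 of_real_add of_real_mult of_real_power)
  from G_eq[OF this] have "v ^ n * \<bar>poly p z\<bar> = norm (G (of_real v))"
    using v by (simp add: norm_mult norm_power)
  also have "\<dots> \<le> M"
    using v by (intro G_le) simp
  finally have "\<bar>poly p z\<bar> \<le> M / v ^ n"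
    using v by (simp add: field_simps)
  then show ?thesis
    by (simp add: v_def n_def power_one_over divide_simps)
qed

section \<open>Sup norms on \<open>[0,x]\<close> and their growth in \<open>x\<close>\<close>

lemma bdd_above_poly_interval:
  fixes p :: "real poly" and x :: real
  shows "bdd_above ((\<lambda>t. \<bar>poly p t\<bar>) ` {0..x})"
  by (intro bounded_imp_bdd_above compact_imp_bounded compact_continuous_image continuous_intros)
    auto

lemma abs_poly_le_sup_norm:
  "t \<in> {0..x} \<Longrightarrow> \<bar>poly (map_poly real_of_int p) t\<bar> \<le> sup_norm_on {0..x} p"
  unfolding sup_norm_on_def by (rule cSUP_upper[OF _ bdd_above_poly_interval])

lemma sup_norm_le:
  "0 \<le> x \<Longrightarrow> (\<And>t. t \<in> {0..x} \<Longrightarrow> \<bar>poly (map_poly real_of_int p) t\<bar> \<le> B)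
    \<Longrightarrow> sup_norm_on {0..x} p \<le> B"
  unfolding sup_norm_on_def by (rule cSUP_least) auto

lemma sup_norm_nonneg: "0 \<le> x \<Longrightarrow> 0 \<le> sup_norm_on {0..x} p"
  using abs_poly_le_sup_norm[of 0 x p] by (meson abs_ge_zero atLeastAtMost_iff order.trans order_refl)

lemma sup_norm_mono: "0 \<le> y \<Longrightarrow> y \<le> x \<Longrightarrow> sup_norm_on {0..y} p \<le> sup_norm_on {0..x} p"
  by (intro sup_norm_le abs_poly_le_sup_norm) auto

lemma sup_norm_growth:
  assumes "0 < y" "y \<le> x"
  shows "sup_norm_on {0..x} p \<le> sup_norm_on {0..y} p * growth_factor (x / y) ^ degree p"
proof (rule sup_norm_le)
  fix t assume t: "t \<in> {0..x}"
  let ?P = "map_poly real_of_int p" and ?M = "sup_norm_on {0..y} p"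
  have M: "0 \<le> ?M"
    using assms by (intro sup_norm_nonneg) simp
  show "\<bar>poly ?P t\<bar> \<le> ?M * growth_factor (x / y) ^ degree p"
  proof (cases "t \<le> y")
    case True
    then have "\<bar>poly ?P t\<bar> \<le> ?M"
      using t by (intro abs_poly_le_sup_norm) auto
    also have "\<dots> \<le> ?M * growth_factor (x / y) ^ degree p"
      using mult_left_mono[OF one_le_power[OF growth_factor_ge_1[of "x / y"]] M] assms by simp
    finally show ?thesis .
  next
    case False
    then have "\<bar>poly ?P t\<bar> \<le> ?M * growth_factor (t / y) ^ degree ?P"
      using assms by (intro poly_growth_outside_interval abs_poly_le_sup_norm) auto
    also have "degree ?P = degree p"
      by (cases "p = 0") (auto intro: degree_map_poly)
    also have "?M * growth_factor (t / y) ^ degree p \<le> ?M * growth_factor (x / y) ^ degree p"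
      using M False t assms growth_factor_ge_1[of "t / y"]
      by (intro mult_left_mono power_mono growth_factor_mono) (auto simp: divide_right_mono)
    finally show ?thesis .
  qed
qed (use assms in auto)

section \<open>The sequence of normalised infima that defines \<open>t_M\<close>\<close>

definition monic_norm_root :: "real \<Rightarrow> nat \<Rightarrow> real" where
  "monic_norm_root x n = (INF p\<in>monic_int_polys n. sup_norm_on {0..x} p powr (1 / real n))"

text \<open>Makes the index sets of the infima nonempty.\<close>

lemma monom_monic: "monom 1 n \<in> monic_int_polys n"
  by (simp add: monic_int_polys_def degree_monom_eq)

lemma bdd_below_powr_image: "bdd_below ((\<lambda>p. f p powr e) ` A)" for f :: "_ \<Rightarrow> real"
  by (rule bdd_belowI2[of _ 0]) simp

lemma monic_norm_root_le:
  "p \<in> monic_int_polys n \<Longrightarrow> monic_norm_root x n \<le> sup_norm_on {0..x} p powr (1 / real n)"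
  unfolding monic_norm_root_def by (rule cINF_lower[OF bdd_below_powr_image])

lemma monic_norm_root_ge:
  "(\<And>p. p \<in> monic_int_polys n \<Longrightarrow> B \<le> sup_norm_on {0..x} p powr (1 / real n))
    \<Longrightarrow> B \<le> monic_norm_root x n"
  unfolding monic_norm_root_def using monom_monic by (intro cINF_greatest) auto

lemma monic_norm_root_nonneg: "0 \<le> monic_norm_root x n"
  by (rule monic_norm_root_ge) simp

lemma monic_norm_root_mono:
  assumes "0 \<le> y" "y \<le> x"
  shows "monic_norm_root y n \<le> monic_norm_root x n"
proof (rule monic_norm_root_ge)
  fix p assume "p \<in> monic_int_polys n"
  then have "monic_norm_root y n \<le> sup_norm_on {0..y} p powr (1 / real n)"
    by (rule monic_norm_root_le)
  also have "\<dots> \<le> sup_norm_on {0..x} p powr (1 / real n)"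
    using assms by (intro powr_mono2 sup_norm_mono sup_norm_nonneg) auto
  finally show "monic_norm_root y n \<le> \<dots>" .
qed

text \<open>The \<open>n\<close>-th root reduces the factor \<open>growth_factor (x / y) ^ n\<close>
  to one independent of \<open>n\<close>, which therefore survives the limit.\<close>

lemma monic_norm_root_growth:
  assumes "0 < y" "y \<le> x" "0 < n"
  shows "monic_norm_root x n \<le> monic_norm_root y n * growth_factor (x / y)"
proof -
  let ?g = "growth_factor (x / y)"
  have g: "1 \<le> ?g"
    using assms by (intro growth_factor_ge_1) simp
  \<comment> \<open>With the factor on the left, the claim is a lower bound for each term of the
    infum on the right, so it may be checked one polynomial at a time.\<close>
  have "monic_norm_root x n / ?g \<le> monic_norm_root y n"
  proof (rule monic_norm_root_ge)
    fix p assume p: "p \<in> monic_int_polys n"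
    then have "monic_norm_root x n \<le> sup_norm_on {0..x} p powr (1 / real n)"
      by (rule monic_norm_root_le)
    also have "\<dots> \<le> (sup_norm_on {0..y} p * ?g ^ n) powr (1 / real n)"
      using assms p sup_norm_growth[of y x p]
      by (intro powr_mono2 sup_norm_nonneg) (auto simp: monic_int_polys_def)
    also have "\<dots> = sup_norm_on {0..y} p powr (1 / real n) * ?g"
      using assms g
      by (simp add: powr_mult sup_norm_nonneg powr_realpow[symmetric] powr_powr)
    finally show "monic_norm_root x n / ?g \<le> sup_norm_on {0..y} p powr (1 / real n)"
      using g by (simp add: field_simps)
  qed
  then show ?thesis
    using g by (simp add: field_simps)
qed

section \<open>Fekete-type argument and existence of the limit\<close>

lemma poly_of_int_mult:
  fixes t :: real
  shows "poly (map_poly of_int (p * q)) t = poly (map_poly of_int p) t * poly (map_poly of_int q) t"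
proof -
  have add: "map_poly of_int (a + b) = map_poly of_int a + (map_poly of_int b :: real poly)" for a b
    by (simp add: poly_eq_iff coeff_map_poly)
  have smult: "map_poly of_int (smult c a) = smult (of_int c) (map_poly of_int a :: real poly)" for a c
    by (simp add: poly_eq_iff coeff_map_poly)
  show ?thesis
    by (induction p) (simp_all add: add smult map_poly_pCons algebra_simps)
qed

lemma poly_of_int_power:
  fixes t :: real
  shows "poly (map_poly of_int (p ^ k)) t = poly (map_poly of_int p) t ^ k"
  by (induction k) (simp_all add: poly_of_int_mult)

text \<open>Writing \<open>n = m q + r\<close> with \<open>r < m\<close>, the polynomial
  \<open>p^q x^r\<close> is monic of degree \<open>n\<close>, and its norm exceeds
  \<open>d^n\<close> at most by a factor \<open>K\<close> independent of \<open>n\<close>, whose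
  \<open>n\<close>-th root tends to 1.\<close>

lemma eventually_monic_norm_root_less:
  assumes x: "0 \<le> x" and m: "0 < m" and c: "monic_norm_root x m < c"
  shows "eventually (\<lambda>n. monic_norm_root x n < c) sequentially"
proof -
  obtain p where p: "p \<in> monic_int_polys m" and "sup_norm_on {0..x} p powr (1 / real m) < c"
    using c monom_monic unfolding monic_norm_root_def
    by (subst (asm) cINF_less_iff[OF _ bdd_below_powr_image]) auto
  \<comment> \<open>The gap between \<open>d\<close> and \<open>c\<close> absorbs the factor
    \<open>K powr (1 / real n)\<close> for large \<open>n\<close>. Being positive, \<open>d\<close>
    can also be divided by, even if the norm of \<open>p\<close> were 0.\<close>
  then obtain d where d: "sup_norm_on {0..x} p powr (1 / real m) < d" "d < c"
    using dense by blast
  then have d0: "0 < d"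
    by (meson le_less_trans powr_ge_zero)
  have "sup_norm_on {0..x} p = (sup_norm_on {0..x} p powr (1 / real m)) ^ m"
    using x m sup_norm_nonneg[of x p] by (cases "sup_norm_on {0..x} p = 0") (auto simp: powr_power)
  also have "\<dots> \<le> d ^ m"
    using d by (intro power_mono) auto
  finally have pd: "sup_norm_on {0..x} p \<le> d ^ m" .
  \<comment> \<open>A bound for \<open>(x / d)^r\<close> for every remainder \<open>r < m\<close>;
    adding 1 makes the base at least 1, so that its powers increase with the exponent.\<close>
  define K where "K = (1 + x / d) ^ m"
  have K: "1 \<le> K"
    using x d0 by (simp add: K_def one_le_power)
  have le: "monic_norm_root x n \<le> d * K powr (1 / real n)" if n: "0 < n" for n
  proof -
    define q r where "q = n div m" and "r = n mod m"
    have n_eq: "n = m * q + r" and r: "r < m"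
      using m by (auto simp: q_def r_def)
    let ?f = "p ^ q * monom 1 r"
    have p': "degree p = m" "lead_coeff p = 1" "p \<noteq> 0"
      using p m by (auto simp: monic_int_polys_def)
    have "degree ?f = n"
      using p' by (simp add: degree_mult_eq degree_power_eq degree_monom_eq n_eq)
    moreover have "lead_coeff ?f = 1"
      using p' by (simp only: lead_coeff_mult lead_coeff_power lead_coeff_monom power_one mult_1)
    ultimately have f: "?f \<in> monic_int_polys n"
      by (simp add: monic_int_polys_def)
    have "sup_norm_on {0..x} ?f \<le> d ^ n * K"
    proof (rule sup_norm_le[OF x])
      fix t assume t: "t \<in> {0..x}"
      have "poly (map_poly real_of_int ?f) t = poly (map_poly real_of_int p) t ^ q * t ^ r"
        by (simp add: poly_of_int_mult poly_of_int_power map_poly_monom poly_monom)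
      then have "\<bar>poly (map_poly real_of_int ?f) t\<bar> = \<bar>poly (map_poly real_of_int p) t\<bar> ^ q * t ^ r"
        using t by (simp add: abs_mult power_abs)
      also have "\<dots> \<le> (d ^ m) ^ q * x ^ r"
        using t x d0 pd abs_poly_le_sup_norm[OF t, of p]
        by (intro mult_mono power_mono) auto
      \<comment> \<open>Since \<open>m q = n - r\<close>, completing \<open>d^(m q)\<close> to
        \<open>d^n\<close> costs a factor \<open>d^r\<close>, which is charged to
        \<open>x^r\<close>.\<close>
      also have "\<dots> = d ^ n * (x / d) ^ r"
        using d0 by (simp add: n_eq power_add power_mult power_divide)
      also have "(x / d) ^ r \<le> (1 + x / d) ^ r"
        using x d0 by (intro power_mono) auto
      also have "\<dots> \<le> K"
        unfolding K_def using r x d0 by (intro power_increasing) auto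
      finally show "\<bar>poly (map_poly real_of_int ?f) t\<bar> \<le> d ^ n * K"
        using d0 by simp
    qed
    then have "sup_norm_on {0..x} ?f powr (1 / real n) \<le> (d ^ n * K) powr (1 / real n)"
      using x by (intro powr_mono2 sup_norm_nonneg) auto
    also have "\<dots> = d * K powr (1 / real n)"
      using d0 K n by (simp add: powr_mult powr_realpow[symmetric] powr_powr)
    finally show ?thesis
      using monic_norm_root_le[OF f, of x] by linarith
  qed
  have "(\<lambda>n. d * K powr (1 / real n)) \<longlonglongrightarrow> d * K powr 0"
    using K by (intro tendsto_intros lim_1_over_n) auto
  then have "eventually (\<lambda>n. d * K powr (1 / real n) < c) sequentially"
    using K d by (intro order_tendstoD(2)) auto
  then show ?thesis
    using eventually_gt_at_top[of 0] by eventually_elim (rule le_less_trans[OF le])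
qed

text \<open>The limit is the infimum \<open>L\<close> over positive degrees: no term lies below
  \<open>L\<close>, and a single term below \<open>c\<close> forces all later ones below
  \<open>c\<close> eventually. Only this convergence gives the \<open>lim\<close> in the definition
  of \<open>t_M\<close> its meaning.\<close>

lemma monic_norm_root_tendsto_t_M:
  assumes "0 \<le> x"
  shows "monic_norm_root x \<longlonglongrightarrow> t_M x"
proof -
  define L where "L = (INF n\<in>{0<..}. monic_norm_root x n)"
  have bdd: "bdd_below (monic_norm_root x ` {0<..})"
    by (rule bdd_belowI2[of _ 0]) (rule monic_norm_root_nonneg)
  have "monic_norm_root x \<longlonglongrightarrow> L"
  proof (rule order_tendstoI)
    fix a assume "a < L"
    have "L \<le> monic_norm_root x n" if "0 < n" for n
      unfolding L_def using that by (intro cINF_lower[OF bdd]) auto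
    then show "eventually (\<lambda>n. a < monic_norm_root x n) sequentially"
      using \<open>a < L\<close> by (intro eventually_mono[OF eventually_gt_at_top[of 0]]) (rule less_le_trans)
  next
    fix c assume "L < c"
    then obtain m where "0 < m" "monic_norm_root x m < c"
      unfolding L_def by (subst (asm) cINF_less_iff[OF _ bdd]) auto
    then show "eventually (\<lambda>n. monic_norm_root x n < c) sequentially"
      by (rule eventually_monic_norm_root_less[OF assms])
  qed
  moreover have "t_M x = lim (monic_norm_root x)"
    unfolding t_M_def monic_int_transfinite_diameter_def monic_norm_root_def ..
  ultimately show ?thesis
    by (simp add: limI)
qed

section \<open>Passage to the limit and continuity of \<open>t_M\<close>\<close>

lemma t_M_nonneg: "0 \<le> x \<Longrightarrow> 0 \<le> t_M x"
  by (rule LIMSEQ_le_const[OF monic_norm_root_tendsto_t_M]) (auto simp: monic_norm_root_nonneg)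

lemma t_M_mono: "0 \<le> y \<Longrightarrow> y \<le> x \<Longrightarrow> t_M y \<le> t_M x"
  by (rule LIMSEQ_le[OF monic_norm_root_tendsto_t_M monic_norm_root_tendsto_t_M])
    (auto simp: monic_norm_root_mono)

lemma t_M_growth:
  assumes "0 < y" "y \<le> x"
  shows "t_M x \<le> t_M y * growth_factor (x / y)"
proof (rule LIMSEQ_le)
  show "monic_norm_root x \<longlonglongrightarrow> t_M x"
    using assms by (intro monic_norm_root_tendsto_t_M) simp
  show "(\<lambda>n. monic_norm_root y n * growth_factor (x / y)) \<longlonglongrightarrow> t_M y * growth_factor (x / y)"
    using assms by (intro tendsto_mult monic_norm_root_tendsto_t_M tendsto_const) simp
  show "\<exists>N. \<forall>n\<ge>N. monic_norm_root x n \<le> monic_norm_root y n * growth_factor (x / y)"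
    using monic_norm_root_growth[OF assms] by (intro exI[of _ 1]) auto
qed

theorem theorem2p3:
  shows "continuous_on {0<..} t_M"
proof -
  have "t_M \<midarrow>a\<rightarrow> t_M a" if a: "0 < a" for a
  proof -
    \<comment> \<open>The quotient of the larger by the smaller point treats both sides of
      \<open>a\<close> at once: it is \<open>a / x\<close> to the left and \<open>x / a\<close> to
      the right.\<close>
    define g where "g x = growth_factor (max x a / min x a)" for x
    have pos: "eventually (\<lambda>x. 0 < x) (at a)"
      using a order_tendstoD(1)[OF tendsto_ident_at] by blast
    have bounds: "t_M a / g x \<le> t_M x \<and> t_M x \<le> t_M a * g x" if x: "0 < x" for x
    proof -
      have g: "1 \<le> g x"
        unfolding g_def using a x by (intro growth_factor_ge_1) (auto simp: max_def min_def)
      show ?thesis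
      proof (cases "x \<le> a")
        case True
        \<comment> \<open>To the left of \<open>a\<close>, growth is applied from \<open>x\<close>
          up to \<open>a\<close>, which bounds \<open>t_M x\<close> from below; the upper bound is
          monotonicity. To the right the roles are exchanged.\<close>
        then have "t_M a / g x \<le> t_M x"
          using t_M_growth[of x a] x g by (simp add: g_def max_def min_def field_simps)
        moreover have "t_M a \<le> t_M a * g x"
          using mult_left_mono[OF g t_M_nonneg[of a]] a by simp
        ultimately show ?thesis
          using t_M_mono[of x a] True x by simp
      next
        case False
        then have "t_M x \<le> t_M a * g x"
          using t_M_growth[of a x] a by (simp add: g_def max_def min_def)
        moreover have "t_M a \<le> t_M x"
          using t_M_mono[of a x] False a by simp
        moreover have "t_M a / g x \<le> t_M a"
          using mult_left_mono[OF g t_M_nonneg[of a]] a g by (simp add: field_simps)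
        ultimately show ?thesis
          by simp
      qed
    qed
    \<comment> \<open>The quotient tends to 1 at \<open>a\<close>, and
      \<open>(sqrt 1 + sqrt 0)^2 = 1\<close>.\<close>
    have "g \<midarrow>a\<rightarrow> (sqrt (max a a / min a a) + sqrt (max a a / min a a - 1))\<^sup>2"
      unfolding g_def growth_factor_def using a by (intro tendsto_intros) auto
    then have g: "g \<midarrow>a\<rightarrow> 1"
      using a by simp
    show ?thesis
    proof (rule tendsto_sandwich)
      show "((\<lambda>x. t_M a / g x) \<longlongrightarrow> t_M a) (at a)"
        using tendsto_divide[OF tendsto_const g, of "t_M a"] by simp
      show "((\<lambda>x. t_M a * g x) \<longlongrightarrow> t_M a) (at a)"
        using tendsto_mult[OF tendsto_const g, of "t_M a"] by simp
    qed (use pos bounds in \<open>auto elim: eventually_mono\<close>)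
  qed
  then show ?thesis
    by (simp add: continuous_on_eq_continuous_at isCont_def)
qed

end
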